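(* Let $G$ be a group acting on a perfect Polish space $X$ by homeomorphisms. Let $w$ be a word over $G$ on $t$ variables $y_1,\ldots,y_t$ which is reduced and non-constant (i.e. $w\notin G$) in $\mathbb{F}_t\ast G$. If $G$ hereditarily separates $X$ and $w$ has a conjugate in $\mathbb{F}_t\ast G$ which is oscillating, then the inequality $w\neq 1$ has a solution in $G$, i.e. there is $\bar g\in G^t$ with $w(\bar g)\neq 1$. Moreover, assume that $w\in\mathbb{F}_t$ or $w=u_kv_k\ldots u_1v_1$, where for each $s$, $1\le s\le k$, $v_s\in G\setminus\{1\}$ and $u_s$ contains only variables. Then for any non-empty open set $O'\subseteq O_w$ there is a tuple $\bar g=(g_1,\ldots,g_t)\in G^t$ such that $w(\bar g)\neq 1$ and for all $i$, $1\le i\le t$, the following conditions hold: (1) $supp(g_i)\subseteq\mathcal{V}_w(O')$; (2) $g_i(v_s\ldots v_1(O'))=v_s\ldots v_1(O')$ for any $s$, $1\le s\le k$.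
   Context: Actions are left actions; products of group elements are applied from right to left. For $g\in G$, $supp(g)=\{x\in X: g(x)\ne x\}$; $Fix(G)$ is the set of points fixed by every element of $G$; $stab_G(A)$ is the pointwise stabilizer of $A\subseteq X$. Hereditarily separating: let $X$ be an infinite metric space, $G$ a permutation group on $X$ consisting of homeomorphisms, with $Fix(G)$ finite. $G$ hereditarily separates $X$ if, for any open and infinite subset $Z\subseteq X$ and any finite subset $Y\subset Z$, the subgroup $stab_G((X\setminus Z)\cup Y)$ does not stabilize any point of $Z\setminus(Y\cup Fix(G))$. Words: $\mathbb{F}_t$ is the free group on the variables $y_1,\ldots,y_t$. A word over $G$ on $t$ variables is an element $w$ of $\mathbb{F}_t\ast G$ in reduced form; $w(\bar g)\in G$ is the value of $w$ at $\bar g\in G^t$. If $w\notin\mathbb{F}_t$, consider $w$ in the form $w=u_kv_k\ldots u_1v_1$, reduced in $\mathbb{F}_t\ast G$, with $k\ge1$, each $u_i$ a word in the variables only and each $v_i\in G\setminus\{1\}$. In this case put $v_0=1$ and $$O_w=\bigcap_{i=0}^{k-1}v_0^{-1}v_1^{-1}\ldots v_i^{-1}\big(supp(v_{i+1})\big),\qquad \mathcal{V}_w(A)=\bigcup_{j=1}^k v_j\ldots v_1(A)\quad(A\subseteq X).$$ If $w\in\mathbb{F}_t$ put $O_w=X\setminus Fix(G)$, and use the convention $k=1$, $v_1=1$ in conditions involving $v_s\ldots v_1$, so that $\mathcal{V}_w(A)=A$. A non-trivial word $w\in\mathbb{F}_t\ast G$ is oscillating if $w\in\mathbb{F}_t$,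 or $w$ is in the form above and $O_w\ne\emptyset$. *)

theory Defs
  imports "HOL-Analysis.Analysis" "HOL-Algebra.Group_Action"
begin

section \<open>The free product of a free group with a group\<close>

text \<open>
  The elements of the free product of the free group on \<open>y\<^sub>1, \<dots>, y\<^sub>t\<close> with \<open>G\<close> are represented by
  their normal forms (reduced words), written from left to right. \<open>Var i True\<close> stands
  for \<open>y\<^sub>i\<close>, \<open>Var i False\<close> for the inverse of \<open>y\<^sub>i\<close>.
\<close>

datatype 'g letter = Var nat bool | Const 'g

fun letter_ok :: "nat \<Rightarrow> ('g, 'm) monoid_scheme \<Rightarrow> 'g letter \<Rightarrow> bool" where
  "letter_ok t G (Var i e) \<longleftrightarrow> i \<in> {1..t}"
| "letter_ok t G (Const a) \<longleftrightarrow> a \<in> carrier G - {\<one>\<^bsub>G\<^esub>}"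

fun clash :: "'g letter \<Rightarrow> 'g letter \<Rightarrow> bool" where
  "clash (Var i e) (Var j d) \<longleftrightarrow> i = j \<and> e \<noteq> d"
| "clash (Const a) (Const b) \<longleftrightarrow> True"
| "clash _ _ \<longleftrightarrow> False"

definition reduced_words :: "nat \<Rightarrow> ('g, 'm) monoid_scheme \<Rightarrow> 'g letter list set" where
  "reduced_words t G =
     {w. (\<forall>l\<in>set w. letter_ok t G l) \<and> successively (\<lambda>l m. \<not> clash l m) w}"

text \<open>Multiplication of a reduced word by a letter on the left, again in reduced form.\<close>

fun letter_mult :: "('g, 'm) monoid_scheme \<Rightarrow> 'g letter \<Rightarrow> 'g letter list \<Rightarrow> 'g letter list" where
  "letter_mult G (Var i e) (Var j d # w) =
     (if i = j \<and> e \<noteq> d then w else Var i e # Var j d # w)"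
| "letter_mult G (Const a) (Const b # w) =
     (if a \<otimes>\<^bsub>G\<^esub> b = \<one>\<^bsub>G\<^esub> then w else Const (a \<otimes>\<^bsub>G\<^esub> b) # w)"
| "letter_mult G l w = l # w"

definition free_prod :: "nat \<Rightarrow> ('g, 'm) monoid_scheme \<Rightarrow> 'g letter list monoid" where
  "free_prod t G =
     \<lparr>carrier = reduced_words t G, mult = (\<lambda>u w. foldr (letter_mult G) u w), one = []\<rparr>"

definition const_words :: "('g, 'm) monoid_scheme \<Rightarrow> 'g letter list set" where
  "const_words G = insert [] {[Const a] | a. a \<in> carrier G - {\<one>\<^bsub>G\<^esub>}}"

definition free_words :: "nat \<Rightarrow> 'g letter list set" where
  "free_words t =
     {w. (\<forall>l\<in>set w. \<exists>i\<in>{1..t}. \<exists>e. l = Var i e) \<and> successively (\<lambda>l m. \<not> clash l m) w}"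

fun letter_value :: "('g, 'm) monoid_scheme \<Rightarrow> (nat \<Rightarrow> 'g) \<Rightarrow> 'g letter \<Rightarrow> 'g" where
  "letter_value G g (Var i e) = (if e then g i else inv\<^bsub>G\<^esub> (g i))"
| "letter_value G g (Const a) = a"

definition word_value :: "('g, 'm) monoid_scheme \<Rightarrow> (nat \<Rightarrow> 'g) \<Rightarrow> 'g letter list \<Rightarrow> 'g" where
  "word_value G g w = foldr (\<lambda>l x. letter_value G g l \<otimes>\<^bsub>G\<^esub> x) w \<one>\<^bsub>G\<^esub>"

subsection \<open>The free product is a group\<close>

lemma successively_Cons_iff:
  "successively P (x # xs) \<longleftrightarrow> (xs = [] \<or> P x (hd xs)) \<and> successively P xs"
  by (cases xs) auto

lemma reduced_words_Cons:
  "l # w \<in> reduced_words t G \<longleftrightarrow>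
     letter_ok t G l \<and> w \<in> reduced_words t G \<and> (w = [] \<or> \<not> clash l (hd w))"
  by (auto simp: reduced_words_def successively_Cons_iff)

lemma Nil_reduced [simp]: "[] \<in> reduced_words t G"
  by (simp add: reduced_words_def)

lemma clash_Const_cong: "clash (Const a) l \<Longrightarrow> clash (Const b) l"
  by (cases l) auto

lemma letter_mult_reduced:
  assumes "group G" "letter_ok t G l" "w \<in> reduced_words t G"
  shows "letter_mult G l w \<in> reduced_words t G"
proof -
  interpret group G by fact
  show ?thesis
    using assms(2,3)
    by (cases "(G, l, w)" rule: letter_mult.cases)
       (auto simp: reduced_words_Cons dest: clash_Const_cong)
qed

lemma foldr_letter_mult_reduced:
  assumes "group G" "\<forall>l\<in>set u. letter_ok t G l" "w \<in> reduced_words t G"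
  shows "foldr (letter_mult G) u w \<in> reduced_words t G"
  using assms(2) by (induction u) (auto intro: letter_mult_reduced assms)

lemma letter_mult_eq_Cons:
  "w = [] \<or> \<not> clash l (hd w) \<Longrightarrow> letter_mult G l w = l # w"
  by (induction G l w rule: letter_mult.induct) auto

lemma foldr_letter_mult_Nil:
  "u \<in> reduced_words t G \<Longrightarrow> foldr (letter_mult G) u [] = u"
  by (induction u) (auto simp: reduced_words_Cons letter_mult_eq_Cons)

lemma letter_mult_Var_cancel:
  assumes "w \<in> reduced_words t G" "e \<noteq> d"
  shows "letter_mult G (Var i e) (letter_mult G (Var i d) w) = w"
proof (cases "\<exists>v. w = Var i e # v")
  case True
  then obtain v where v: "w = Var i e # v" by blast
  hence "v = [] \<or> \<not> clash (Var i e) (hd v)"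
    using assms(1) by (simp add: reduced_words_Cons)
  thus ?thesis using v assms(2) by (auto simp: letter_mult_eq_Cons)
next
  case False
  hence "letter_mult G (Var i d) w = Var i d # w"
    using assms(2) by (intro letter_mult_eq_Cons) (cases w; cases "hd w"; auto)
  thus ?thesis using assms(2) by simp
qed

lemma letter_mult_Const_Const:
  assumes "group G" "w \<in> reduced_words t G" "a \<in> carrier G" "a \<noteq> \<one>\<^bsub>G\<^esub>" "b \<in> carrier G"
  shows "letter_mult G (Const a) (letter_mult G (Const b) w) =
         (if a \<otimes>\<^bsub>G\<^esub> b = \<one>\<^bsub>G\<^esub> then w else letter_mult G (Const (a \<otimes>\<^bsub>G\<^esub> b)) w)"
proof -
  interpret group G by fact
  show ?thesis
  proof (cases "\<exists>c v. w = Const c # v")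
    case True
    then obtain c v where w: "w = Const c # v" by blast
    hence c: "c \<in> carrier G" "c \<noteq> \<one>\<^bsub>G\<^esub>" and v: "v = [] \<or> \<not> clash (Const d) (hd v)" for d
      using assms(2) by (auto simp: reduced_words_Cons dest: clash_Const_cong[of d _ c])
    have e: "a \<otimes>\<^bsub>G\<^esub> (b \<otimes>\<^bsub>G\<^esub> c) = a \<otimes>\<^bsub>G\<^esub> b \<otimes>\<^bsub>G\<^esub> c"
      using assms c by (simp add: m_assoc)
    show ?thesis
    proof (cases "b \<otimes>\<^bsub>G\<^esub> c = \<one>\<^bsub>G\<^esub>")
      case True
      have "a \<otimes>\<^bsub>G\<^esub> b \<otimes>\<^bsub>G\<^esub> c = a"
        using e True assms by simp
      moreover have "a = c" if "a \<otimes>\<^bsub>G\<^esub> b = \<one>\<^bsub>G\<^esub>"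
        using that calculation c by simp
      ultimately show ?thesis
        using True w v c assms(4) by (auto simp: letter_mult_eq_Cons)
    next
      case False
      show ?thesis
        using False w v c e assms
        by (auto simp: letter_mult_eq_Cons)
    qed
  next
    case False
    hence "letter_mult G (Const d) w = Const d # w" for d
      by (cases w; cases "hd w") auto
    thus ?thesis by simp
  qed
qed

lemma letter_mult_foldr:
  assumes "group G" "letter_ok t G l" "z \<in> reduced_words t G" "w \<in> reduced_words t G"
  shows "foldr (letter_mult G) (letter_mult G l z) w =
         letter_mult G l (foldr (letter_mult G) z w)"
proof (cases z)
  case Nil
  thus ?thesis by (simp add: letter_mult_eq_Cons)
next
  case (Cons m v)
  have v: "foldr (letter_mult G) v w \<in> reduced_words t G"
    using assms Cons by (intro foldr_letter_mult_reduced) (auto simp: reduced_words_def)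
  have m: "letter_ok t G m"
    using assms(3) Cons by (simp add: reduced_words_Cons)
  show ?thesis
    using Cons assms(2) m
    by (cases l; cases m)
       (auto simp: letter_mult_Var_cancel[OF v] letter_mult_Const_Const[OF assms(1) v])
qed

theorem group_free_prod:
  assumes "group G"
  shows "group (free_prod t G)"
proof (rule groupI)
  interpret group G by fact
  show "\<one>\<^bsub>free_prod t G\<^esub> \<in> carrier (free_prod t G)"
    by (simp add: free_prod_def)
  fix x assume x: "x \<in> carrier (free_prod t G)"
  show "\<one>\<^bsub>free_prod t G\<^esub> \<otimes>\<^bsub>free_prod t G\<^esub> x = x"
    by (simp add: free_prod_def)
  have *: "foldr (letter_mult G) (u @ u') y \<in> reduced_words t G"
    if "u \<in> reduced_words t G" "u' \<in> reduced_words t G" "y \<in> reduced_words t G" for u u' y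
    using that assms by (intro foldr_letter_mult_reduced) (auto simp: reduced_words_def)
  fix y assume y: "y \<in> carrier (free_prod t G)"
  show "x \<otimes>\<^bsub>free_prod t G\<^esub> y \<in> carrier (free_prod t G)"
    using x y *[of x "[]" y] by (simp add: free_prod_def)
  fix z assume z: "z \<in> carrier (free_prod t G)"
  show "x \<otimes>\<^bsub>free_prod t G\<^esub> y \<otimes>\<^bsub>free_prod t G\<^esub> z =
        x \<otimes>\<^bsub>free_prod t G\<^esub> (y \<otimes>\<^bsub>free_prod t G\<^esub> z)"
  proof -
    have "foldr (letter_mult G) (foldr (letter_mult G) x y) z =
          foldr (letter_mult G) x (foldr (letter_mult G) y z)"
      using x unfolding free_prod_def partial_object.simps
    proof (induction x)
      case (Cons l x)
      have "foldr (letter_mult G) x y \<in> reduced_words t G"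
        using Cons.prems y *[of x "[]" y] by (simp add: reduced_words_Cons free_prod_def)
      with Cons y z show ?case
        using letter_mult_foldr[OF assms, of t l "foldr (letter_mult G) x y" z]
        by (simp add: reduced_words_Cons free_prod_def)
    qed simp
    thus ?thesis by (simp add: free_prod_def)
  qed
next
  interpret group G by fact
  fix x assume "x \<in> carrier (free_prod t G)"
  hence "x \<in> reduced_words t G" by (simp add: free_prod_def)
  hence "\<exists>y. (\<forall>l\<in>set y. letter_ok t G l) \<and> foldr (letter_mult G) (y @ x) [] = []"
  proof (induction x)
    case (Cons l x)
    then obtain y where y: "\<forall>l\<in>set y. letter_ok t G l" "foldr (letter_mult G) (y @ x) [] = []"
      by (auto simp: reduced_words_Cons)
    have x: "x \<in> reduced_words t G" and l: "letter_ok t G l"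
      using Cons.prems by (auto simp: reduced_words_Cons)
    have "\<exists>m. letter_ok t G m \<and> letter_mult G m (letter_mult G l x) = x"
    proof (cases l)
      case (Var i e)
      have "letter_mult G (Var i (\<not> e)) (letter_mult G (Var i e) x) = x"
        by (rule letter_mult_Var_cancel[OF x]) simp
      moreover have "letter_ok t G (Var i (\<not> e))"
        using l Var by simp
      ultimately show ?thesis
        unfolding Var by (intro exI[of _ "Var i (\<not> e)"] conjI)
    next
      case (Const a)
      thus ?thesis using l letter_mult_Const_Const[OF assms x, of "inv\<^bsub>G\<^esub> a" a]
        by (intro exI[of _ "Const (inv\<^bsub>G\<^esub> a)"]) (auto simp: inv_eq_1_iff)
    qed
    then obtain m where m: "letter_ok t G m" "letter_mult G m (letter_mult G l x) = x" by (elim exE conjE)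
    show ?case
      using y m x by (intro exI[of _ "y @ [m]"]) (auto simp: foldr_letter_mult_Nil[OF x])
  qed (simp add: exI[of _ "[]"])
  then obtain y where y: "\<forall>l\<in>set y. letter_ok t G l" "foldr (letter_mult G) (y @ x) [] = []"
    by blast
  define z where "z = foldr (letter_mult G) y []"
  have x: "x \<in> reduced_words t G" by fact
  have z: "z \<in> reduced_words t G"
    unfolding z_def using y by (intro foldr_letter_mult_reduced assms) auto
  have "foldr (letter_mult G) (foldr (letter_mult G) y []) x = foldr (letter_mult G) y x"
    using y(1)
  proof (induction y)
    case (Cons l y)
    thus ?case
      using x letter_mult_foldr[OF assms, of t l "foldr (letter_mult G) y []" x]
      by (auto simp: foldr_letter_mult_reduced[OF assms])
  qed simp
  moreover have "foldr (letter_mult G) y x = []"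
    using y(2) by (simp add: foldr_letter_mult_Nil[OF x])
  ultimately show "\<exists>y\<in>carrier (free_prod t G). y \<otimes>\<^bsub>free_prod t G\<^esub> x = \<one>\<^bsub>free_prod t G\<^esub>"
    using z by (intro bexI[of _ z]) (auto simp: free_prod_def z_def)
qed


section \<open>Actions\<close>

definition acts_by_homeos ::
  "('g, 'm) monoid_scheme \<Rightarrow> ('g \<Rightarrow> 'a::topological_space \<Rightarrow> 'a) \<Rightarrow> bool" where
  "acts_by_homeos G \<phi> \<longleftrightarrow>
     group_action G UNIV \<phi> \<and> (\<forall>g\<in>carrier G. homeomorphic_map euclidean euclidean (\<phi> g))"

definition supp :: "('g \<Rightarrow> 'a \<Rightarrow> 'a) \<Rightarrow> 'g \<Rightarrow> 'a set" where
  "supp \<phi> g = {x. \<phi> g x \<noteq> x}"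

definition Fix :: "('g, 'm) monoid_scheme \<Rightarrow> ('g \<Rightarrow> 'a \<Rightarrow> 'a) \<Rightarrow> 'a set" where
  "Fix G \<phi> = {x. \<forall>g\<in>carrier G. \<phi> g x = x}"

definition pointwise_stab ::
  "('g, 'm) monoid_scheme \<Rightarrow> ('g \<Rightarrow> 'a \<Rightarrow> 'a) \<Rightarrow> 'a set \<Rightarrow> 'g set" where
  "pointwise_stab G \<phi> A = {g \<in> carrier G. \<forall>a\<in>A. \<phi> g a = a}"

text \<open>A permutation group is a group with a faithful action.\<close>

definition hereditarily_separates ::
  "('g, 'm) monoid_scheme \<Rightarrow> ('g \<Rightarrow> 'a::metric_space \<Rightarrow> 'a) \<Rightarrow> bool" where
  "hereditarily_separates G \<phi> \<longleftrightarrow>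
     infinite (UNIV :: 'a set) \<and> faithful_action G UNIV \<phi> \<and> acts_by_homeos G \<phi> \<and>
     finite (Fix G \<phi>) \<and>
     (\<forall>Z Y. open Z \<and> infinite Z \<and> finite Y \<and> Y \<subset> Z \<longrightarrow>
        (\<forall>z \<in> Z - (Y \<union> Fix G \<phi>). \<not> (\<forall>g \<in> pointwise_stab G \<phi> ((UNIV - Z) \<union> Y). \<phi> g z = z)))"


section \<open>Oscillating words\<close>

text \<open>
  In the product \<open>w = u\<^sub>k v\<^sub>k \<dots> u\<^sub>1 v\<^sub>1\<close> the blocks are listed from left to right, so that \<open>bs\<close> is
  \<open>[(u\<^sub>k, v\<^sub>k), \<dots>, (u\<^sub>1, v\<^sub>1)]\<close>. Since \<open>w\<close> is reduced, \<open>u\<^sub>s\<close> is non-trivial for \<open>s < k\<close>; it is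
  not required that \<open>u\<^sub>k\<close> is non-trivial.
\<close>

definition block_word :: "nat \<Rightarrow> ('g, 'm) monoid_scheme \<Rightarrow> 'g letter list \<Rightarrow> bool" where
  "block_word t G w \<longleftrightarrow> w \<in> carrier (free_prod t G) \<and>
     (\<exists>bs. bs \<noteq> [] \<and> (\<forall>(u, v)\<in>set bs. u \<in> free_words t \<and> v \<in> carrier G - {\<one>\<^bsub>G\<^esub>}) \<and>
           w = concat (map (\<lambda>(u, v). u @ [Const v]) bs))"

text \<open>The list \<open>[v\<^sub>1, \<dots>, v\<^sub>k]\<close>, i.e. the constants of a word read from right to left.\<close>

fun coeffs :: "'g letter list \<Rightarrow> 'g list" where
  "coeffs [] = []"
| "coeffs (Var i e # w) = coeffs w"
| "coeffs (Const a # w) = coeffs w @ [a]"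

lemma coeffs_append: "coeffs (u @ w) = coeffs w @ coeffs u"
  by (induction u rule: coeffs.induct) auto

lemma coeffs_free_words: "u \<in> free_words t \<Longrightarrow> coeffs u = []"
proof -
  have "\<forall>l\<in>set u. \<exists>i e. l = Var i e \<Longrightarrow> coeffs u = []"
    by (induction u rule: coeffs.induct) auto
  thus "u \<in> free_words t \<Longrightarrow> coeffs u = []"
    unfolding free_words_def by blast
qed

lemma coeffs_blocks:
  assumes "\<forall>(u, v)\<in>set bs. u \<in> free_words t"
  shows "coeffs (concat (map (\<lambda>(u, v). u @ [Const v]) bs)) = rev (map snd bs)"
  using assms by (induction bs) (auto simp: coeffs_append coeffs_free_words)

text \<open>The product \<open>v\<^sub>s \<dots> v\<^sub>1\<close>, equal to \<open>\<one>\<close> for \<open>s = 0\<close>.\<close>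

definition coeff_prod :: "('g, 'm) monoid_scheme \<Rightarrow> 'g list \<Rightarrow> nat \<Rightarrow> 'g" where
  "coeff_prod G vs s = foldl (\<lambda>x v. v \<otimes>\<^bsub>G\<^esub> x) \<one>\<^bsub>G\<^esub> (take s vs)"

text \<open>
  The set \<open>O\<^sub>w\<close>, meaningful for non-trivial words that have only variables or are of block form.
  Here \<open>v\<^sub>0\<^sup>-\<^sup>1 v\<^sub>1\<^sup>-\<^sup>1 \<dots> v\<^sub>i\<^sup>-\<^sup>1\<close> is the inverse of \<open>v\<^sub>i \<dots> v\<^sub>1\<close>,
  and \<open>v\<^sub>i\<^sub>+\<^sub>1\<close> is \<open>coeffs w ! i\<close>.
\<close>

definition osc_set ::
  "nat \<Rightarrow> ('g, 'm) monoid_scheme \<Rightarrow> ('g \<Rightarrow> 'a \<Rightarrow> 'a) \<Rightarrow> 'g letter list \<Rightarrow> 'a set" where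
  "osc_set t G \<phi> w =
     (if w \<in> free_words t then UNIV - Fix G \<phi>
      else \<Inter>i\<in>{0..<length (coeffs w)}.
             \<phi> (inv\<^bsub>G\<^esub> (coeff_prod G (coeffs w) i)) ` supp \<phi> (coeffs w ! i))"

text \<open>The convention \<open>k = 1\<close>, \<open>v\<^sub>1 = \<one>\<close> for words in variables only.\<close>

definition coeffs1 :: "nat \<Rightarrow> ('g, 'm) monoid_scheme \<Rightarrow> 'g letter list \<Rightarrow> 'g list" where
  "coeffs1 t G w = (if w \<in> free_words t then [\<one>\<^bsub>G\<^esub>] else coeffs w)"

definition osc_range ::
  "nat \<Rightarrow> ('g, 'm) monoid_scheme \<Rightarrow> ('g \<Rightarrow> 'a \<Rightarrow> 'a) \<Rightarrow> 'g letter list \<Rightarrow> 'a set \<Rightarrow> 'a set" where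
  "osc_range t G \<phi> w A =
     (\<Union>j\<in>{1..length (coeffs1 t G w)}. \<phi> (coeff_prod G (coeffs1 t G w) j) ` A)"

definition oscillating ::
  "nat \<Rightarrow> ('g, 'm) monoid_scheme \<Rightarrow> ('g \<Rightarrow> 'a \<Rightarrow> 'a) \<Rightarrow> 'g letter list \<Rightarrow> bool" where
  "oscillating t G \<phi> w \<longleftrightarrow>
     w \<in> carrier (free_prod t G) \<and> w \<noteq> \<one>\<^bsub>free_prod t G\<^esub> \<and>
     (w \<in> free_words t \<or> block_word t G w \<and> osc_set t G \<phi> w \<noteq> {})"

end

theory Submission
  imports Defs
begin

text \<open>
  Fix a point \<open>p\<close> and apply the letters of \<open>w\<close> to it one after the other, from right to left.
  Whenever a variable is about to be applied, its value is corrected by an element supported in a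
  small open set so that the next point of the trajectory is new while the earlier part of the
  trajectory does not change; this is possible because in a hereditarily separating group the
  pointwise stabilizers of finite sets have infinite local orbits. The constants move the
  trajectory to new points because it stays in the translates of \<open>O\<^sub>w\<close>. Hence the last point
  differs from \<open>p\<close>. To control supports and invariant sets one starts in an open \<open>U' \<subseteq> O'\<close> all of
  whose relevant translates are pairwise equal or disjoint, and are contained in or disjoint from
  those of \<open>O'\<close>.
\<close>

section \<open>Evaluation of words as a homomorphism\<close>

section \<open>Word values\<close>

lemma word_value_simps [simp]:
  "word_value G g [] = \<one>\<^bsub>G\<^esub>"
  "word_value G g (l # w) = letter_value G g l \<otimes>\<^bsub>G\<^esub> word_value G g w"
  by (simp_all add: word_value_def)

lemma letter_value_closed:
  assumes "group G" "letter_ok t G l" "g \<in> {1..t} \<rightarrow> carrier G"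
  shows "letter_value G g l \<in> carrier G"
proof -
  interpret group G by fact
  show ?thesis using assms by (cases l) (auto simp: Pi_iff)
qed

lemma word_value_closed:
  assumes "group G" "\<forall>l\<in>set w. letter_ok t G l" "g \<in> {1..t} \<rightarrow> carrier G"
  shows "word_value G g w \<in> carrier G"
proof -
  interpret group G by fact
  show ?thesis using assms(2) by (induction w) (auto intro: letter_value_closed[OF assms(1) _ assms(3)])
qed

lemma reduced_words_letter_ok: "w \<in> reduced_words t G \<Longrightarrow> \<forall>l\<in>set w. letter_ok t G l"
  by (simp add: reduced_words_def)

text \<open>Only a clash makes \<open>letter_mult\<close> differ from \<open>Cons\<close>: either a
  variable cancels against its inverse or two constants merge, and evaluation respects both.\<close>

lemma word_value_letter_mult:
  assumes "group G" "letter_ok t G l" "\<forall>m\<in>set w. letter_ok t G m" "g \<in> {1..t} \<rightarrow> carrier G"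
  shows "word_value G g (letter_mult G l w) = letter_value G g l \<otimes>\<^bsub>G\<^esub> word_value G g w"
proof -
  interpret group G by fact
  show ?thesis
  proof (cases "w = [] \<or> \<not> clash l (hd w)")
    case True
    then show ?thesis by (simp add: letter_mult_eq_Cons)
  next
    case False
    then obtain m u where w: "w = m # u" and clash: "clash l m" by (cases w) auto
    have u: "word_value G g u \<in> carrier G"
      using assms(3,4) w by (intro word_value_closed[OF assms(1)]) auto
    show ?thesis
    proof (cases l)
      case (Var i e)
      then have m: "m = Var i (\<not> e)" using clash by (cases m) auto
      have "g i \<in> carrier G" using assms(2,4) Var by auto
      then have "g i \<otimes>\<^bsub>G\<^esub> (inv\<^bsub>G\<^esub> g i \<otimes>\<^bsub>G\<^esub> word_value G g u) = word_value G g u"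
        "inv\<^bsub>G\<^esub> g i \<otimes>\<^bsub>G\<^esub> (g i \<otimes>\<^bsub>G\<^esub> word_value G g u) = word_value G g u"
        using u by (simp_all flip: m_assoc)
      then show ?thesis using Var m w by simp
    next
      case (Const a)
      then obtain b where m: "m = Const b" using clash by (cases m) auto
      have "a \<in> carrier G" "b \<in> carrier G" using assms(2,3) Const m w by auto
      then have "a \<otimes>\<^bsub>G\<^esub> (b \<otimes>\<^bsub>G\<^esub> word_value G g u) = a \<otimes>\<^bsub>G\<^esub> b \<otimes>\<^bsub>G\<^esub> word_value G g u"
        using u by (simp add: m_assoc)
      then show ?thesis using Const m w u by simp
    qed
  qed
qed

lemma word_value_mult:
  assumes "group G" "u \<in> carrier (free_prod t G)" "w \<in> carrier (free_prod t G)"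
    and g: "g \<in> {1..t} \<rightarrow> carrier G"
  shows "word_value G g (u \<otimes>\<^bsub>free_prod t G\<^esub> w) = word_value G g u \<otimes>\<^bsub>G\<^esub> word_value G g w"
proof -
  interpret group G by fact
  have w: "w \<in> reduced_words t G" using assms by (simp add: free_prod_def)
  have wv: "word_value G g w \<in> carrier G"
    using word_value_closed[OF assms(1) reduced_words_letter_ok[OF w] g] .
  have "\<forall>l\<in>set u. letter_ok t G l" using assms by (simp add: free_prod_def reduced_words_def)
  then have "word_value G g (foldr (letter_mult G) u w) = word_value G g u \<otimes>\<^bsub>G\<^esub> word_value G g w"
  proof (induction u)
    case (Cons l u)
    have "\<forall>m\<in>set (foldr (letter_mult G) u w). letter_ok t G m"
      using Cons.prems foldr_letter_mult_reduced[OF assms(1) _ w] reduced_words_letter_ok by force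
    then show ?case
      using Cons word_value_closed[OF assms(1) _ g, of u] letter_value_closed[OF assms(1) _ g, of l] wv
      by (simp add: word_value_letter_mult[OF assms(1) _ _ g] m_assoc)
  qed (use wv in simp)
  then show ?thesis by (simp add: free_prod_def)
qed

text \<open>Used in contraposition: a tuple solving the inequality for a conjugate of
  \<open>w\<close> solves it for \<open>w\<close>.\<close>

lemma word_value_conj_eq_one:
  assumes "group G" "c \<in> carrier (free_prod t G)" "w \<in> carrier (free_prod t G)"
    and g: "g \<in> {1..t} \<rightarrow> carrier G" and one: "word_value G g w = \<one>\<^bsub>G\<^esub>"
  shows "word_value G g (c \<otimes>\<^bsub>free_prod t G\<^esub> w \<otimes>\<^bsub>free_prod t G\<^esub> inv\<^bsub>free_prod t G\<^esub> c) = \<one>\<^bsub>G\<^esub>"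
proof -
  interpret group G by fact
  interpret F: group "free_prod t G" using group_free_prod[OF assms(1)] .
  note mult = word_value_mult[OF assms(1) _ _ g]
  have c: "word_value G g c \<in> carrier G"
    using assms(2) word_value_closed[OF assms(1) reduced_words_letter_ok g]
    by (simp add: free_prod_def)
  have "word_value G g (c \<otimes>\<^bsub>free_prod t G\<^esub> w \<otimes>\<^bsub>free_prod t G\<^esub> inv\<^bsub>free_prod t G\<^esub> c)
      = word_value G g c \<otimes>\<^bsub>G\<^esub> word_value G g (inv\<^bsub>free_prod t G\<^esub> c)"
    using assms c by (simp add: mult)
  also have "\<dots> = word_value G g (c \<otimes>\<^bsub>free_prod t G\<^esub> inv\<^bsub>free_prod t G\<^esub> c)"
    using assms(2) by (intro mult[symmetric]) auto
  also have "\<dots> = \<one>\<^bsub>G\<^esub>"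
    using F.r_inv[OF assms(2)] by (simp add: free_prod_def)
  finally show ?thesis .
qed

section \<open>Open subsets with controlled translates\<close>

section \<open>Shrinking open sets\<close>

text \<open>Otherwise removing all points but one, a finite and hence closed set, would leave an
  open singleton.\<close>

lemma perfect_infinite_open:
  fixes S :: "'a::{perfect_space, t1_space} set"
  assumes "open S" "S \<noteq> {}"
  shows "infinite S"
proof
  assume "finite S"
  obtain x where x: "x \<in> S" using assms by blast
  have "open (S - (S - {x}))"
    using assms \<open>finite S\<close> by (intro open_Diff finite_imp_closed) auto
  also have "S - (S - {x}) = {x}" using x by blast
  finally show False using not_open_singleton by blast
qed

text \<open>The indices are treated one at a time; as \<open>P a\<close> is inherited by subsets,
  later shrinking does not destroy what was achieved earlier.\<close>

lemma open_shrink_finite: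
  assumes "finite A" "open U" "U \<noteq> {}"
    and shrink: "\<And>a V. a \<in> A \<Longrightarrow> open V \<Longrightarrow> V \<noteq> {} \<Longrightarrow> V \<subseteq> U \<Longrightarrow> \<exists>V'\<subseteq>V. open V' \<and> V' \<noteq> {} \<and> P a V'"
    and mono: "\<And>a V V'. a \<in> A \<Longrightarrow> P a V \<Longrightarrow> V' \<subseteq> V \<Longrightarrow> P a V'"
  shows "\<exists>V\<subseteq>U. open V \<and> V \<noteq> {} \<and> (\<forall>a\<in>A. P a V)"
  using assms(1) shrink mono
proof (induction A)
  case empty
  then show ?case using assms by blast
next
  case (insert b A)
  have "\<exists>V\<subseteq>U. open V \<and> V \<noteq> {} \<and> (\<forall>a\<in>A. P a V)"
  proof (rule insert.IH)
    fix a V assume "a \<in> A" "open V" "V \<noteq> {}" "V \<subseteq> U"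
    then show "\<exists>V'\<subseteq>V. open V' \<and> V' \<noteq> {} \<and> P a V'" by (intro insert.prems(1)) auto
  next
    fix a V V' assume "a \<in> A" "P a V" "V' \<subseteq> V"
    then show "P a V'" by (intro insert.prems(2)[of a V V']) auto
  qed
  then obtain V where V: "V \<subseteq> U" "open V" "V \<noteq> {}" "\<forall>a\<in>A. P a V" by (elim exE conjE)
  have "\<exists>V'\<subseteq>V. open V' \<and> V' \<noteq> {} \<and> P b V'"
    using V by (intro insert.prems(1)) auto
  then obtain V' where V': "V' \<subseteq> V" "open V'" "V' \<noteq> {}" "P b V'" by (elim exE conjE)
  have "P a V'" if "a \<in> A" for a
    using V(4) V'(1) that by (intro insert.prems(2)[of a V V']) auto
  then have "\<forall>a\<in>insert b A. P a V'" using V'(4) by simp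
  moreover have "V' \<subseteq> U" using V(1) V'(1) by simp
  ultimately show ?case using V'(2,3) by (intro exI[of _ V']) simp
qed

lemma open_shrink_images:
  fixes f :: "'i \<Rightarrow> 'a::t2_space \<Rightarrow> 'a"
  assumes "finite I" "open U" "U \<noteq> {}"
    and cont: "\<And>i. i \<in> I \<Longrightarrow> continuous_on UNIV (f i)"
    and opn: "\<And>i. i \<in> I \<Longrightarrow> open (f i ` U)"
  shows "\<exists>V\<subseteq>U. open V \<and> V \<noteq> {} \<and>
    (\<forall>i\<in>I. \<forall>j\<in>I. (f i ` V = f j ` V \<or> f i ` V \<inter> f j ` V = {}) \<and>
                   (f i ` V \<subseteq> f j ` U \<or> f i ` V \<inter> f j ` U = {}))"
proof -
  \<comment> \<open>Equality of two images is not inherited by subsets, so \<open>P\<close> asks for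
    pointwise equality of \<open>f i\<close> and \<open>f j\<close> instead.\<close>
  define P where "P = (\<lambda>(i, j) V. ((\<forall>x\<in>V. f i x = f j x) \<or> f i ` V \<inter> f j ` V = {}) \<and>
                   (f i ` V \<subseteq> f j ` U \<or> f i ` V \<inter> f j ` U = {}))"
  have preimage: "open (f i -` T)" if "i \<in> I" "open T" for i T
    using cont[OF that(1)] that(2) by (simp add: continuous_on_open_vimage)
  have "\<exists>V\<subseteq>U. open V \<and> V \<noteq> {} \<and> (\<forall>a\<in>I \<times> I. P a V)"
  proof (rule open_shrink_finite)
    fix a V assume a: "a \<in> I \<times> I" and V: "open V" "V \<noteq> {}" "V \<subseteq> U"
    obtain i j where ij: "a = (i, j)" "i \<in> I" "j \<in> I" using a by blast
    have "\<exists>V1\<subseteq>V. open V1 \<and> V1 \<noteq> {} \<and> ((\<forall>x\<in>V1. f i x = f j x) \<or> f i ` V1 \<inter> f j ` V1 = {})"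
    proof (cases "\<forall>x\<in>V. f i x = f j x")
      case False
      then obtain x where x: "x \<in> V" "f i x \<noteq> f j x" by blast
      then obtain A B where AB: "open A" "open B" "f i x \<in> A" "f j x \<in> B" "A \<inter> B = {}"
        using hausdorff by metis
      \<comment> \<open>Restricting to points sent into disjoint neighbourhoods of the two values at
        \<open>x\<close> makes the images disjoint.\<close>
      show ?thesis
        using x V AB preimage[OF ij(2) AB(1)] preimage[OF ij(3) AB(2)]
        by (intro exI[of _ "V \<inter> f i -` A \<inter> f j -` B"]) auto
    qed (use V in blast)
    then obtain V1 where V1: "V1 \<subseteq> V" "open V1" "V1 \<noteq> {}"
      "(\<forall>x\<in>V1. f i x = f j x) \<or> f i ` V1 \<inter> f j ` V1 = {}" by blast
    show "\<exists>V'\<subseteq>V. open V' \<and> V' \<noteq> {} \<and> P a V'"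
    proof (cases "f i ` V1 \<inter> f j ` U = {}")
      case False
      \<comment> \<open>The image of \<open>U\<close> under \<open>f j\<close> is open, so its
        preimage under \<open>f i\<close> can be cut out; the alternative reached for
        \<open>V1\<close> survives in the smaller set.\<close>
      let ?V' = "V1 \<inter> f i -` (f j ` U)"
      have "open ?V'" using V1(2) preimage[OF ij(2) opn[OF ij(3)]] by blast
      moreover have "?V' \<noteq> {}" "?V' \<subseteq> V" using False V1(1) by auto
      moreover have "(\<forall>x\<in>?V'. f i x = f j x) \<or> f i ` ?V' \<inter> f j ` ?V' = {}"
        using V1(4) by blast
      moreover have "f i ` ?V' \<subseteq> f j ` U" by blast
      ultimately show ?thesis unfolding P_def ij(1) prod.case by blast
    next
      case True
      then show ?thesis using V1 unfolding P_def ij(1) prod.case by blast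
    qed
  next
    fix a V V' assume "a \<in> I \<times> I" "P a V" "V' \<subseteq> V"
    then show "P a V'" unfolding P_def by (cases a) (simp only: prod.case, blast)
  qed (use assms in auto)
  then obtain V where V: "V \<subseteq> U" "open V" "V \<noteq> {}" "\<forall>a\<in>I \<times> I. P a V" by blast
  have "(f i ` V = f j ` V \<or> f i ` V \<inter> f j ` V = {}) \<and> (f i ` V \<subseteq> f j ` U \<or> f i ` V \<inter> f j ` U = {})"
    if "i \<in> I" "j \<in> I" for i j
  proof -
    have "P (i, j) V" using V that by blast
    moreover have "f i ` V = f j ` V" if "\<forall>x\<in>V. f i x = f j x"
      using that by (intro image_cong) auto
    ultimately show ?thesis unfolding P_def prod.case by blast
  qed
  then show ?thesis using V(1-3) by (intro exI[of _ V]) simp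
qed

section \<open>Supports and local orbits\<close>

section \<open>Hereditarily separating actions\<close>

locale separating_action = group_action G UNIV \<phi>
  for G :: "('g, 'm) monoid_scheme" (structure)
    and \<phi> :: "'g \<Rightarrow> 'a::{metric_space, perfect_space} \<Rightarrow> 'a" +
  assumes separates: "hereditarily_separates G \<phi>"

sublocale separating_action \<subseteq> group G
  using group_hom group_hom.axioms(1) by blast

context separating_action
begin

lemma act_mult: "g \<in> carrier G \<Longrightarrow> h \<in> carrier G \<Longrightarrow> \<phi> (g \<otimes> h) x = \<phi> g (\<phi> h x)"
  by (simp add: composition_rule)

lemma act_one [simp]: "\<phi> \<one> x = x"
  by (metis UNIV_I id_eq_one restrict_apply)

lemma act_inv [simp]:
  assumes "g \<in> carrier G"
  shows "\<phi> (inv g) (\<phi> g x) = x" "\<phi> g (\<phi> (inv g) x) = x"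
  using assms by (simp_all flip: act_mult)

lemma act_eq_iff: "g \<in> carrier G \<Longrightarrow> \<phi> g x = \<phi> g y \<longleftrightarrow> x = y"
  by (metis act_inv(1))

lemma homeo: "g \<in> carrier G \<Longrightarrow> homeomorphic_map euclidean euclidean (\<phi> g)"
  using separates by (simp add: hereditarily_separates_def acts_by_homeos_def)

lemma continuous_act:
  assumes "g \<in> carrier G"
  shows "continuous_on S (\<phi> g)"
proof -
  have "continuous_on UNIV (\<phi> g)"
    using homeomorphic_imp_continuous_map[OF homeo[OF assms]] by simp
  then show ?thesis by (rule continuous_on_subset) simp
qed

lemma open_act_image: "g \<in> carrier G \<Longrightarrow> open S \<Longrightarrow> open (\<phi> g ` S)"
  using homeomorphic_imp_open_map[OF homeo] by (simp add: open_map_def)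

lemma open_supp: "g \<in> carrier G \<Longrightarrow> open (supp \<phi> g)"
  unfolding supp_def by (intro open_Collect_neq continuous_act continuous_on_id)

lemma act_Fix_iff:
  assumes "g \<in> carrier G"
  shows "\<phi> g x \<in> Fix G \<phi> \<longleftrightarrow> x \<in> Fix G \<phi>"
proof
  assume "\<phi> g x \<in> Fix G \<phi>"
  then have "\<phi> (inv g) (\<phi> g x) = \<phi> g x" using assms by (simp add: Fix_def)
  then show "x \<in> Fix G \<phi>" using assms \<open>\<phi> g x \<in> Fix G \<phi>\<close> by simp
qed (use assms in \<open>simp add: Fix_def\<close>)

lemma finite_Fix: "finite (Fix G \<phi>)"
  using separates by (simp add: hereditarily_separates_def)

text \<open>\<open>g\<close> permutes \<open>W\<close> and fixes everything outside, so no point can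
  enter or leave \<open>T\<close>.\<close>

lemma image_eq_if_supp:
  assumes g: "g \<in> carrier G" and supp: "supp \<phi> g \<subseteq> W" and W: "W \<subseteq> T \<or> W \<inter> T = {}"
  shows "\<phi> g ` T = T"
proof -
  have fix_out: "\<phi> g x = x" if "x \<notin> W" for x using supp that by (auto simp: supp_def)
  have closed: "\<phi> g x \<in> T \<longleftrightarrow> x \<in> T" for x
  proof (cases "x \<in> W")
    case True
    \<comment> \<open>If the image of \<open>x\<close> left \<open>W\<close>, then \<open>g\<close>
      would fix it, and injectivity would force it to equal \<open>x\<close>.\<close>
    then have "\<phi> g x \<in> W"
      using fix_out[of "\<phi> g x"] act_eq_iff[OF g, of "\<phi> g x" x] by metis
    then show ?thesis using True W by auto
  qed (simp add: fix_out)
  show ?thesis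
  proof
    show "T \<subseteq> \<phi> g ` T"
    proof
      fix x assume "x \<in> T"
      then have "\<phi> (inv g) x \<in> T" using closed[of "\<phi> (inv g) x"] g by simp
      then show "x \<in> \<phi> g ` T" using act_inv(2)[OF g, of x] by (metis image_eqI)
    qed
  qed (auto simp: closed)
qed

text \<open>Otherwise the orbit of \<open>z\<close> under the admissible elements is finite, and its
  other points can be included among the fixed ones when separation is applied to \<open>Z\<close>.
  As the finite set \<open>F\<close> is arbitrary, the orbit is infinite.\<close>

lemma local_orbit_infinite:
  assumes Z: "open Z" "Z \<inter> Fix G \<phi> = {}" and z: "z \<in> Z" "z \<notin> Y" and "finite Y" "finite F"
  shows "\<exists>h\<in>carrier G. supp \<phi> h \<subseteq> Z \<and> (\<forall>y\<in>Y. \<phi> h y = y) \<and> \<phi> h z \<notin> F"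
proof (rule ccontr)
  assume neg: "\<not> ?thesis"
  define H where "H = {h \<in> carrier G. supp \<phi> h \<subseteq> Z \<and> (\<forall>y\<in>Y. \<phi> h y = y)}"
  \<comment> \<open>\<open>z\<close> is left out because separation concerns points outside the
    finite set. That set must lie in \<open>Z\<close>; points of \<open>Y\<close> outside
    \<open>Z\<close> are fixed anyway.\<close>
  define Y' where "Y' = (Y \<inter> Z) \<union> ((\<lambda>h. \<phi> h z) ` H - {z})"
  have orbit: "(\<lambda>h. \<phi> h z) ` H \<subseteq> F" using neg by (auto simp: H_def)
  have "\<phi> h z \<in> Z" if "h \<in> H" for h
    using image_eq_if_supp[of h Z Z] that z by (auto simp: H_def)
  then have Y': "finite Y'" "Y' \<subset> Z" "z \<notin> Y'"
    using finite_subset[OF orbit] assms by (auto simp: Y'_def)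
  have "infinite Z" using perfect_infinite_open Z z by blast
  then obtain g where g: "g \<in> pointwise_stab G \<phi> ((UNIV - Z) \<union> Y')" and gz: "\<phi> g z \<noteq> z"
    using separates Z z Y' unfolding hereditarily_separates_def by (metis DiffI IntI UnE emptyE)
  \<comment> \<open>The element \<open>g\<close> moves \<open>z\<close> inside its orbit under \<open>H\<close>, but fixes the rest of this orbit.\<close>
  have "supp \<phi> g \<subseteq> Z" "\<forall>y\<in>Y'. \<phi> g y = y" "g \<in> carrier G"
    using g by (auto simp: pointwise_stab_def supp_def)
  then have "g \<in> H" by (auto simp: H_def Y'_def supp_def)
  then have "\<phi> g z \<in> Y'" using gz by (auto simp: Y'_def)
  then have "\<phi> g (\<phi> g z) = \<phi> g z" using \<open>\<forall>y\<in>Y'. \<phi> g y = y\<close> by blast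
  then show False using gz \<open>g \<in> carrier G\<close> by (simp add: act_eq_iff)
qed

section \<open>Building the tuple along a trajectory\<close>

section \<open>Trajectories\<close>

text \<open>Both side conditions on the values are packed into one set, which is a subgroup:
  corrected values and their inverses remain admissible.\<close>

definition preserving :: "'a set \<Rightarrow> 'a set set \<Rightarrow> 'g set" where
  "preserving V \<T> = {g \<in> carrier G. supp \<phi> g \<subseteq> V \<and> (\<forall>T\<in>\<T>. \<phi> g ` T = T)}"

lemma subgroup_preserving: "subgroup (preserving V \<T>) G"
proof
  show "preserving V \<T> \<subseteq> carrier G" by (auto simp: preserving_def)
  show "\<one> \<in> preserving V \<T>" by (auto simp: preserving_def supp_def)
next
  fix g h assume gh: "g \<in> preserving V \<T>" "h \<in> preserving V \<T>"
  then have c: "g \<in> carrier G" "h \<in> carrier G" by (auto simp: preserving_def)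
  have "\<phi> (g \<otimes> h) ` T = \<phi> g ` \<phi> h ` T" for T
    using c by (simp add: act_mult image_image)
  moreover have "supp \<phi> (g \<otimes> h) \<subseteq> supp \<phi> g \<union> supp \<phi> h"
    using c by (auto simp: supp_def act_mult)
  ultimately show "g \<otimes> h \<in> preserving V \<T>"
    using gh unfolding preserving_def by auto
next
  fix g assume g: "g \<in> preserving V \<T>"
  then have c: "g \<in> carrier G" by (auto simp: preserving_def)
  have "\<phi> (inv g) ` T = T" if "T \<in> \<T>" for T
  proof -
    have "\<phi> (inv g) ` \<phi> g ` T = T" using c by (simp add: image_image)
    then show ?thesis using g that by (simp add: preserving_def)
  qed
  moreover have "supp \<phi> (inv g) \<subseteq> supp \<phi> g"
  proof
    fix x assume "x \<in> supp \<phi> (inv g)"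
    then show "x \<in> supp \<phi> g" using act_inv(1)[OF c, of x] by (auto simp: supp_def)
  qed
  ultimately show "inv g \<in> preserving V \<T>"
    using g c unfolding preserving_def by auto
qed

text \<open>Only images under proper suffixes are collected. The end point is left out, so that its
  novelty can be expressed as non-membership.\<close>

primrec visited :: "(nat \<Rightarrow> 'g) \<Rightarrow> 'a \<Rightarrow> 'g letter list \<Rightarrow> 'a set" where
  "visited g p [] = {}"
| "visited g p (l # w) = insert (\<phi> (word_value G g w) p) (visited g p w)"

lemma finite_visited: "finite (visited g p w)"
  by (induction w) auto

lemma start_visited: "w \<noteq> [] \<Longrightarrow> p \<in> visited g p w"
proof (induction w)
  case (Cons l w)
  then show ?case by (cases w) auto
qed simp

text \<open>
  The last hypothesis puts every point reached by a letter \<open>Var i (\<not> e)\<close> into \<open>S\<close>; since the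
  new value of \<open>Var i e\<close> returns from there as before, its inverse has not changed either.
\<close>

lemma visited_cong:
  assumes g: "\<And>j. g j \<in> carrier G" "\<And>j. g' j \<in> carrier G"
    and other: "\<And>j. j \<noteq> i \<Longrightarrow> g' j = g j"
    and agree: "\<And>s. s \<in> S \<Longrightarrow> \<phi> (letter_value G g' (Var i e)) s = \<phi> (letter_value G g (Var i e)) s"
    and "\<forall>l\<in>set w. letter_ok t G l" "visited g p w \<subseteq> S"
    and "w = [] \<or> hd w \<noteq> Var i (\<not> e) \<or> \<phi> (word_value G g w) p \<in> S"
  shows "\<phi> (word_value G g' w) p = \<phi> (word_value G g w) p \<and> visited g' p w = visited g p w"
  using assms(5-7)
proof (induction w)
  case (Cons l w)
  \<comment> \<open>The point reached by \<open>w\<close> is visited by \<open>l # w\<close>, so it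
    lies in \<open>S\<close>, and the last hypothesis holds for the tail whatever its first letter
    is.\<close>
  have IH: "\<phi> (word_value G g' w) p = \<phi> (word_value G g w) p" "visited g' p w = visited g p w"
    using Cons by auto
  let ?x = "\<phi> (word_value G g w) p"
  have x: "?x \<in> S" using Cons.prems by simp
  have lc: "letter_value G k m \<in> carrier G" if "\<And>j. k j \<in> carrier G" "letter_ok t G m" for k m
    using that letter_value_closed[OF is_group, of t m k] by blast
  have vc: "word_value G k w \<in> carrier G" if "\<And>j. k j \<in> carrier G" for k
    using that word_value_closed[OF is_group, of w t k] Cons.prems by auto
  have l: "letter_ok t G l" using Cons.prems by simp
  have value_Cons: "\<phi> (word_value G k (l # w)) p = \<phi> (letter_value G k l) (\<phi> (word_value G k w) p)"
    if "\<And>j. k j \<in> carrier G" for k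
    using lc[OF that l] vc[OF that] by (simp add: act_mult)
  have "\<phi> (letter_value G g' l) ?x = \<phi> (letter_value G g l) ?x"
  proof (cases l)
    case (Var j d)
    consider "j \<noteq> i" | "j = i" "d = e" | "j = i" "d \<noteq> e" by blast
    then show ?thesis
    proof cases
      case 1
      then show ?thesis using Var other by simp
    next
      case 2
      then show ?thesis using Var agree[OF x] by simp
    next
      case 3
      let ?y = "\<phi> (letter_value G g l) ?x"
      have "?y \<in> S"
      proof -
        have "l = Var i (\<not> e)" using 3 Var by auto
        then have "\<phi> (word_value G g (l # w)) p \<in> S" using Cons.prems(3) by simp
        then show ?thesis using value_Cons[of g, OF g(1)] by simp
      qed
      then have "\<phi> (letter_value G g' (Var i e)) ?y = \<phi> (letter_value G g (Var i e)) ?y"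
        by (rule agree)
      also have "\<dots> = ?x" using 3 Var g by (cases e) auto
      finally have "\<phi> (letter_value G g' l) ?x = \<phi> (letter_value G g' l) (\<phi> (letter_value G g' (Var i e)) ?y)"
        by simp
      also have "\<dots> = ?y" using 3 Var g by (cases e) auto
      finally show ?thesis .
    qed
  qed simp
  then show ?case using IH value_Cons[of g, OF g(1)] value_Cons[of g', OF g(2)] by simp
qed simp

text \<open>\<open>W n\<close> holds the trajectory after \<open>n\<close> constants, and
  \<open>J\<close> contains the indices \<open>n\<close> at which variables act. The clause on
  \<open>a\<close> is a look-ahead: a constant cannot be corrected, so the variable applied just
  before it must be chosen such that the constant leads to a new point. Words beginning with a
  constant are exempt, since a reduced word has no second constant immediately to the left.\<close>

lemma trajectory_exists:
  fixes W :: "nat \<Rightarrow> 'a set"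
  assumes W: "\<And>j. j \<in> J \<Longrightarrow> open (W j)" "\<And>j. j \<in> J \<Longrightarrow> W j \<inter> Fix G \<phi> = {}"
    and \<T>: "\<And>j T. j \<in> J \<Longrightarrow> T \<in> \<T> \<Longrightarrow> W j \<subseteq> T \<or> W j \<inter> T = {}" "W ` J \<subseteq> \<T>"
    and p: "p \<in> W 0"
    and "w \<in> reduced_words t G"
    and "\<And>n. n < length (coeffs w) \<Longrightarrow>
           \<phi> (coeffs w ! n) ` W n \<subseteq> W (Suc n) \<and> W n \<subseteq> supp \<phi> (coeffs w ! n)"
    and "\<And>y i e u. w = y @ Var i e # u \<Longrightarrow> length (coeffs u) \<in> J"
    and "a \<in> carrier G"
  shows "\<exists>g. (\<forall>i. g i \<in> preserving (\<Union> (W ` J)) \<T>) \<and>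
           \<phi> (word_value G g w) p \<in> W (length (coeffs w)) - visited g p w \<and>
           (w = [] \<or> \<not> clash (Const a) (hd w) \<longrightarrow>
              \<phi> a (\<phi> (word_value G g w) p) \<notin> visited g p w)"
  using assms(6-9)
proof (induction w arbitrary: a)
  case Nil
  then show ?case
    using p subgroup.one_closed[OF subgroup_preserving] by (intro exI[of _ "\<lambda>_. \<one>"]) auto
next
  case (Cons l w)
  let ?P = "preserving (\<Union> (W ` J)) \<T>"
  interpret P: subgroup ?P G by (rule subgroup_preserving)
  have l: "letter_ok t G l" and w: "w \<in> reduced_words t G" "w = [] \<or> \<not> clash l (hd w)"
    using Cons.prems by (auto simp: reduced_words_Cons)
  have coeffs_w: "\<phi> (coeffs w ! n) ` W n \<subseteq> W (Suc n) \<and> W n \<subseteq> supp \<phi> (coeffs w ! n)"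
    if "n < length (coeffs w)" for n
    using Cons.prems(2)[of n] that by (cases l) (auto simp: nth_append)
  have J_w: "length (coeffs u) \<in> J" if "w = y @ Var i e # u" for y i e u
    using Cons.prems(3)[of "l # y" i e u] that by simp
  have IH: "\<exists>g. (\<forall>i. g i \<in> ?P) \<and>
      \<phi> (word_value G g w) p \<in> W (length (coeffs w)) - visited g p w \<and>
      (w = [] \<or> \<not> clash (Const b) (hd w) \<longrightarrow>
         \<phi> b (\<phi> (word_value G g w) p) \<notin> visited g p w)" if "b \<in> carrier G" for b
    by (rule Cons.IH[OF w(1) _ _ that]) (fact coeffs_w J_w)+
  have ok: "\<forall>m\<in>set w. letter_ok t G m" by (rule reduced_words_letter_ok[OF w(1)])
  have value_Cons: "\<phi> (word_value G k (l # w)) p = \<phi> (letter_value G k l) (\<phi> (word_value G k w) p)"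
    if "\<And>j. k j \<in> carrier G" for k
    using letter_value_closed[OF is_group l, of k] word_value_closed[OF is_group ok, of k] that
    by (auto simp: act_mult)
  show ?case
  proof (cases l)
    case (Const c)
    have c: "c \<in> carrier G" using l Const by simp
    \<comment> \<open>The look-ahead for \<open>c\<close> keeps the new point off the earlier ones;
      it differs from \<open>?x\<close> because \<open>?x\<close> lies in the support of
      \<open>c\<close>.\<close>
    obtain g where g: "\<forall>i. g i \<in> ?P" "\<phi> (word_value G g w) p \<in> W (length (coeffs w)) - visited g p w"
      "\<phi> c (\<phi> (word_value G g w) p) \<notin> visited g p w"
      using IH[OF c] w(2) Const by auto
    let ?x = "\<phi> (word_value G g w) p"
    have "\<phi> c ?x \<in> W (Suc (length (coeffs w)))" "\<phi> c ?x \<noteq> ?x"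
      using Cons.prems(2)[of "length (coeffs w)"] Const g(2) by (auto simp: supp_def)
    then show ?thesis
      using g Const value_Cons[of g] by (intro exI[of _ g]) auto
  next
    case (Var i e)
    have n: "length (coeffs w) \<in> J" using Cons.prems(3)[of "[]" i e w] Var by simp
    let ?W = "W (length (coeffs w))"
    \<comment> \<open>The look-ahead for the tail gets the default \<open>\<one>\<close>; the one
      for \<open>a\<close> is secured by the correction \<open>h\<close> below.\<close>
    obtain g where g: "\<forall>i. g i \<in> ?P" "\<phi> (word_value G g w) p \<in> ?W - visited g p w"
      using IH[OF one_closed] by auto
    define x where "x = \<phi> (word_value G g w) p"
    define S where "S = visited g p w"
    define \<gamma> where "\<gamma> = letter_value G g l"
    have x: "x \<in> ?W" "x \<notin> S" using g by (auto simp: x_def S_def)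
    have \<gamma>: "\<gamma> \<in> ?P" using g(1) Var by (simp add: \<gamma>_def)
    have \<gamma>c: "\<gamma> \<in> carrier G" using P.subset \<gamma> by blast
    have z: "\<phi> \<gamma> x \<in> ?W" "\<phi> \<gamma> x \<notin> \<phi> \<gamma> ` S"
    proof -
      have "?W \<in> \<T>" using n \<T>(2) by blast
      then have "\<phi> \<gamma> ` ?W = ?W" using \<gamma> unfolding preserving_def by blast
      then show "\<phi> \<gamma> x \<in> ?W" using x(1) by blast
      show "\<phi> \<gamma> x \<notin> \<phi> \<gamma> ` S" using x(2) \<gamma>c by (auto simp: act_eq_iff)
    qed
    have "finite S" by (simp add: S_def finite_visited)
    \<comment> \<open>Fixing the images of \<open>S\<close> under \<open>\<gamma>\<close> will leave
      the earlier trajectory intact; the preimages under \<open>a\<close> are avoided for the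
      look-ahead.\<close>
    then have "finite (\<phi> \<gamma> ` S)" "finite (insert x S \<union> \<phi> (inv a) ` insert x S)" by simp_all
    from local_orbit_infinite[OF W(1)[OF n] W(2)[OF n] z this]
    obtain h where h: "h \<in> carrier G" "supp \<phi> h \<subseteq> ?W" "\<forall>y\<in>\<phi> \<gamma> ` S. \<phi> h y = y"
      "\<phi> h (\<phi> \<gamma> x) \<notin> insert x S \<union> \<phi> (inv a) ` insert x S"
      by (elim bexE conjE)
    have "\<phi> h ` T = T" if "T \<in> \<T>" for T
      by (rule image_eq_if_supp[OF h(1,2) \<T>(1)[OF n that]])
    moreover have "supp \<phi> h \<subseteq> \<Union> (W ` J)" using h(2) n by blast
    ultimately have hP: "h \<in> ?P" using h(1) unfolding preserving_def by blast
    define \<gamma>' where "\<gamma>' = h \<otimes> \<gamma>"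
    have \<gamma>'c: "\<gamma>' \<in> carrier G" using h(1) \<gamma>c by (simp add: \<gamma>'_def)
    \<comment> \<open>When \<open>e\<close> is false the letter stands for the inverse of the
      variable, so the variable must receive \<open>inv \<gamma>'\<close>.\<close>
    define g' where "g' = g(i := if e then \<gamma>' else inv \<gamma>')"
    have g': "g' j \<in> ?P" for j
      using g(1) hP \<gamma> by (simp add: g'_def \<gamma>'_def)
    have gc: "g j \<in> carrier G" "g' j \<in> carrier G" for j using g(1) g' P.subset by blast+
    have letter: "letter_value G g' l = \<gamma>'" using Var \<gamma>'c by (simp add: g'_def)
    have same: "\<phi> (word_value G g' w) p = x \<and> visited g' p w = S"
      unfolding x_def S_def
    proof (rule visited_cong[where i = i and e = e and S = S and t = t])
      show "\<phi> (letter_value G g' (Var i e)) s = \<phi> (letter_value G g (Var i e)) s" if "s \<in> S" for s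
      proof -
        have "\<phi> h (\<phi> \<gamma> s) = \<phi> \<gamma> s" using h(3) that by blast
        then have "\<phi> \<gamma>' s = \<phi> \<gamma> s" using h(1) \<gamma>c by (simp add: \<gamma>'_def act_mult)
        then show ?thesis using letter Var by (simp only: \<gamma>_def)
      qed
      \<comment> \<open>Reducedness enters here: \<open>w\<close> does not begin with the inverse of
        \<open>l\<close>. This matters because its end point \<open>x\<close> is not in
        \<open>S\<close>.\<close>
      show "w = [] \<or> hd w \<noteq> Var i (\<not> e) \<or> \<phi> (word_value G g w) p \<in> S"
        using w(2) Var by auto
    qed (use gc ok in \<open>auto simp: g'_def S_def\<close>)
    let ?x' = "\<phi> \<gamma>' x"
    have "\<phi> (word_value G g' (l # w)) p = ?x'"
      using value_Cons[of g'] gc letter same by simp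
    moreover have "visited g' p (l # w) = insert x S" using same by simp
    moreover have "?x' \<in> ?W"
    proof -
      have "\<phi> h ` ?W = ?W" by (rule image_eq_if_supp[OF h(1,2)]) simp
      then have "\<phi> h (\<phi> \<gamma> x) \<in> ?W" using z(1) by blast
      then show ?thesis using h(1) \<gamma>c by (simp add: \<gamma>'_def act_mult)
    qed
    moreover have x': "?x' \<notin> insert x S" "?x' \<notin> \<phi> (inv a) ` insert x S"
      using h(1,4) \<gamma>c by (simp_all add: \<gamma>'_def act_mult)
    moreover have "\<phi> a ?x' \<notin> insert x S"
      using x'(2) Cons.prems(4) by (metis act_inv(1) image_eqI)
    moreover have "length (coeffs (l # w)) = length (coeffs w)" using Var by simp
    ultimately show ?thesis using g' by (intro exI[of _ g']) simp
  qed
qed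

end

section \<open>From oscillating words to trajectories\<close>

section \<open>The solution of the inequality\<close>

lemma coeff_prod_Suc:
  "n < length vs \<Longrightarrow> coeff_prod G vs (Suc n) = vs ! n \<otimes>\<^bsub>G\<^esub> coeff_prod G vs n"
  by (simp add: coeff_prod_def take_Suc_conv_app_nth)

lemma coeff_prod_0 [simp]: "coeff_prod G vs 0 = \<one>\<^bsub>G\<^esub>"
  by (simp add: coeff_prod_def)

lemma coeff_prod_closed:
  assumes "monoid G" "set vs \<subseteq> carrier G"
  shows "coeff_prod G vs n \<in> carrier G"
proof -
  interpret monoid G by fact
  have "x \<in> carrier G \<Longrightarrow> foldl (\<lambda>x v. v \<otimes>\<^bsub>G\<^esub> x) x us \<in> carrier G" if "set us \<subseteq> carrier G" for x us
    using that by (induction us arbitrary: x) auto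
  then show ?thesis
    unfolding coeff_prod_def using assms(2) set_take_subset[of n vs] by blast
qed

lemma set_coeffs: "set (coeffs w) = {a. Const a \<in> set w}"
  by (induction w rule: coeffs.induct) auto

text \<open>What matters is that the rightmost letter is the constant \<open>v\<^sub>1\<close>: no
  variable acts before the first constant.\<close>

lemma block_word_coeffs:
  assumes "block_word t G w"
  shows "\<exists>w' a. w = w' @ [Const a]" "coeffs w \<noteq> []" "w \<notin> free_words t"
proof -
  obtain bs where bs: "bs \<noteq> []" "w = concat (map (\<lambda>(u, v). u @ [Const v]) bs)"
    using assms by (auto simp: block_word_def)
  obtain bs' u v where "bs = bs' @ [(u, v)]"
    using bs(1) by (metis rev_exhaust surj_pair)
  then have w: "w = (concat (map (\<lambda>(u, v). u @ [Const v]) bs') @ u) @ [Const v]"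
    using bs(2) by simp
  then show "\<exists>w' a. w = w' @ [Const a]" by blast
  show "coeffs w \<noteq> []" using w by (simp add: coeffs_append)
  then show "w \<notin> free_words t" using coeffs_free_words by blast
qed

context separating_action
begin

lemma osc_set_open:
  assumes "w \<in> carrier (free_prod t G)"
  shows "open (osc_set t G \<phi> w)"
proof -
  have "set (coeffs w) \<subseteq> carrier G"
    using assms by (force simp: set_coeffs free_prod_def reduced_words_def)
  then have "open (\<phi> (inv (coeff_prod G (coeffs w) i)) ` supp \<phi> (coeffs w ! i))"
    if "i < length (coeffs w)" for i
    using that coeff_prod_closed[OF is_monoid, of "coeffs w" i]
    by (intro open_act_image open_supp inv_closed) auto
  then show ?thesis
    using finite_imp_closed[OF finite_Fix] by (auto simp: osc_set_def)
qed

text \<open>\<open>oscillating\<close> requires non-emptiness only for block words; here it holds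
  because a perfect space is infinite and \<open>Fix\<close> is finite.\<close>

lemma osc_set_free_nonempty:
  assumes "w \<in> free_words t"
  shows "osc_set t G \<phi> w \<noteq> {}"
proof -
  have "infinite (UNIV :: 'a set)" by (rule perfect_infinite_open) simp_all
  then have "UNIV - Fix G \<phi> \<noteq> {}"
    using Diff_infinite_finite[OF finite_Fix] infinite_imp_nonempty by blast
  then show ?thesis using assms unfolding osc_set_def by simp
qed

text \<open>Serves both claims of the theorem: the first with a conjugate of the given word and its
  whole \<open>osc_set\<close> as \<open>U\<close>, the second with the given word and open
  set.\<close>

lemma inequality_solution:
  assumes w: "w \<in> carrier (free_prod t G)" "w \<noteq> []" "w \<in> free_words t \<or> block_word t G w"
    and U: "open U" "U \<noteq> {}" "U \<subseteq> osc_set t G \<phi> w"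
  shows "\<exists>g. (\<forall>i. g i \<in> carrier G) \<and> word_value G g w \<noteq> \<one> \<and>
    (\<forall>i. supp \<phi> (g i) \<subseteq> osc_range t G \<phi> w U \<and>
         (\<forall>s \<in> {1..length (coeffs1 t G w)}.
            \<phi> (g i) ` (\<phi> (coeff_prod G (coeffs1 t G w) s) ` U) =
            \<phi> (coeff_prod G (coeffs1 t G w) s) ` U))"
proof -
  define k where "k = length (coeffs w)"
  define f where "f = coeff_prod G (coeffs w)"
  \<comment> \<open>The possible numbers of constants that have acted before a variable does: none
    for a free word, at least one for a block word.\<close>
  define J where "J = (if w \<in> free_words t then {0} else {1..k})"
  have red: "w \<in> reduced_words t G" using w by (simp add: free_prod_def)
  have cs: "set (coeffs w) \<subseteq> carrier G"
    using red by (force simp: set_coeffs reduced_words_def)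
  then have f: "f n \<in> carrier G" for n
    unfolding f_def by (rule coeff_prod_closed[OF is_monoid])
  have f_Suc: "\<phi> (f (Suc n)) x = \<phi> (coeffs w ! n) (\<phi> (f n) x)" if "n < k" for n x
  proof -
    have "coeffs w ! n \<in> carrier G" using that cs by (auto simp: k_def)
    then show ?thesis
      using that f[of n] by (simp add: f_def k_def coeff_prod_Suc act_mult)
  qed
  \<comment> \<open>For a free word the convention \<open>k = 1\<close>,
    \<open>v\<^sub>1 = \<one>\<close> yields the same single translate as index
    \<open>0\<close>.\<close>
  have ranges: "(\<lambda>s. \<phi> (coeff_prod G (coeffs1 t G w) s) ` U) ` {1..length (coeffs1 t G w)} =
      (\<lambda>j. \<phi> (f j) ` U) ` J"
    by (auto simp: coeffs1_def J_def f_def k_def coeff_prod_def)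
  have "finite J" by (simp add: J_def)
  have cont: "continuous_on UNIV (\<phi> (f j))" and opn: "open (\<phi> (f j) ` U)" for j
    using continuous_act[OF f] open_act_image[OF f U(1)] .
  obtain V where V: "V \<subseteq> U" "open V" "V \<noteq> {}"
    and V_images: "\<forall>i\<in>J. \<forall>j\<in>J. (\<phi> (f i) ` V = \<phi> (f j) ` V \<or> \<phi> (f i) ` V \<inter> \<phi> (f j) ` V = {}) \<and>
      (\<phi> (f i) ` V \<subseteq> \<phi> (f j) ` U \<or> \<phi> (f i) ` V \<inter> \<phi> (f j) ` U = {})"
    using open_shrink_images[OF \<open>finite J\<close> U(1,2), of "\<lambda>j. \<phi> (f j)", OF cont opn]
    by (elim exE conjE)
  define W where "W = (\<lambda>n. \<phi> (f n) ` V)"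
  \<comment> \<open>Invariance of the translates of \<open>V\<close> keeps the trajectory in place
    under corrections; invariance of those of \<open>U\<close> is what is claimed.\<close>
  define \<T> where "\<T> = W ` J \<union> (\<lambda>j. \<phi> (f j) ` U) ` J"
  have moved: "W n \<subseteq> supp \<phi> (coeffs w ! n)" if "n < k" for n
  proof
    fix x assume "x \<in> W n"
    then obtain u where u: "u \<in> U" "x = \<phi> (f n) u" using V(1) by (auto simp: W_def)
    have "w \<notin> free_words t" using that coeffs_free_words by (force simp: k_def)
    \<comment> \<open>\<open>coeffs w ! n\<close> is \<open>v\<^sub>n\<^sub>+\<^sub>1\<close>, and
      index \<open>n\<close> of the intersection pulls its support back along
      \<open>f n\<close>.\<close>
    then have "u \<in> \<phi> (inv (f n)) ` supp \<phi> (coeffs w ! n)"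
      using u(1) U(3) that by (auto simp: osc_set_def f_def k_def)
    then show "x \<in> supp \<phi> (coeffs w ! n)" using u(2) f by auto
  qed
  have V_Fix: "x \<notin> Fix G \<phi>" if "x \<in> V" for x
  proof (cases "w \<in> free_words t")
    case True
    then show ?thesis using that V(1) U(3) by (auto simp: osc_set_def)
  next
    case False
    \<comment> \<open>For a block word the first constant moves every point of
      \<open>V\<close>.\<close>
    then have "0 < k" using w(3) block_word_coeffs(2) by (auto simp: k_def)
    then have "coeffs w ! 0 \<in> carrier G" "\<phi> (coeffs w ! 0) x \<noteq> x"
      using cs moved[of 0] that by (auto simp: k_def W_def f_def supp_def image_subset_iff)
    then show ?thesis by (auto simp: Fix_def)
  qed
  obtain p where p: "p \<in> V" using V(3) by blast
  \<comment> \<open>No letter follows the whole word, so the look-ahead gets the default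
    \<open>\<one>\<close>.\<close>
  have "\<exists>g. (\<forall>i. g i \<in> preserving (\<Union> (W ` J)) \<T>) \<and>
      \<phi> (word_value G g w) p \<in> W (length (coeffs w)) - visited g p w \<and>
      (w = [] \<or> \<not> clash (Const \<one>) (hd w) \<longrightarrow>
         \<phi> \<one> (\<phi> (word_value G g w) p) \<notin> visited g p w)"
  proof (rule trajectory_exists[where t = t])
    show "open (W j)" for j unfolding W_def by (rule open_act_image[OF f V(2)])
    show "W j \<inter> Fix G \<phi> = {}" for j using V_Fix act_Fix_iff[OF f] by (auto simp: W_def)
    show "W j \<subseteq> T \<or> W j \<inter> T = {}" if j: "j \<in> J" and T: "T \<in> \<T>" for j T
    proof -
      obtain i where "i \<in> J" "T = W i \<or> T = \<phi> (f i) ` U" using T by (auto simp: \<T>_def)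
      then show ?thesis using V_images j unfolding W_def by blast
    qed
    show "p \<in> W 0" using p by (simp add: W_def f_def)
    show "\<phi> (coeffs w ! n) ` W n \<subseteq> W (Suc n) \<and> W n \<subseteq> supp \<phi> (coeffs w ! n)"
      if "n < length (coeffs w)" for n
      using that moved[of n] by (auto simp: W_def f_Suc k_def)
    show "length (coeffs u) \<in> J" if u: "w = y @ Var i e # u" for y i e u
    proof (cases "w \<in> free_words t")
      case True
      then have "coeffs w = []" by (rule coeffs_free_words)
      then show ?thesis using u True by (simp add: J_def coeffs_append)
    next
      case False
      \<comment> \<open>The rightmost constant stands to the right of every variable, hence in
        \<open>u\<close>, so at least one constant has acted.\<close>
      then obtain w' a where "w = w' @ [Const a]" using w(3) block_word_coeffs(1) by blast
      with u have "last (Var i e # u) = Const a" by (metis last_appendR last_snoc list.distinct(1))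
      then have "u \<noteq> []" "last u = Const a" by (auto split: if_splits)
      then have "Const a \<in> set u" by (metis last_in_set)
      then have "coeffs u \<noteq> []" using set_coeffs[of u] by auto
      then show ?thesis using u False by (auto simp: J_def k_def coeffs_append Suc_le_eq)
    qed
    show "W ` J \<subseteq> \<T>" by (simp add: \<T>_def)
  qed (simp_all add: red)
  then obtain g where g: "\<And>i. g i \<in> preserving (\<Union> (W ` J)) \<T>"
    and new: "\<phi> (word_value G g w) p \<notin> visited g p w" by blast
  \<comment> \<open>The start \<open>p\<close> is itself visited, so a new end point differs from
    \<open>p\<close>.\<close>
  have "word_value G g w \<noteq> \<one>" using new start_visited[OF w(2), of p g] by auto
  moreover have "g i \<in> carrier G" for i using g by (auto simp: preserving_def)
  moreover have "supp \<phi> (g i) \<subseteq> osc_range t G \<phi> w U" for i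
  proof -
    have "supp \<phi> (g i) \<subseteq> \<Union> (W ` J)" using g by (auto simp: preserving_def)
    also have "\<dots> \<subseteq> \<Union> ((\<lambda>j. \<phi> (f j) ` U) ` J)" using V(1) by (auto simp: W_def)
    finally show ?thesis unfolding osc_range_def ranges .
  qed
  moreover have "\<phi> (g i) ` (\<phi> (coeff_prod G (coeffs1 t G w) s) ` U) =
      \<phi> (coeff_prod G (coeffs1 t G w) s) ` U" if "s \<in> {1..length (coeffs1 t G w)}" for i s
  proof -
    have "\<phi> (coeff_prod G (coeffs1 t G w) s) ` U \<in> \<T>"
      using ranges that unfolding \<T>_def by blast
    then show ?thesis using g[of i] unfolding preserving_def by blast
  qed
  ultimately show ?thesis by (intro exI[of _ g]) simp
qed

end

section \<open>The two claims assembled\<close>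

theorem theorem2p8:
  fixes G :: "('g, 'm) monoid_scheme"
    and \<phi> :: "'g \<Rightarrow> 'a::{polish_space, perfect_space} \<Rightarrow> 'a"
    and t :: nat
    and w :: "'g letter list"
  assumes "acts_by_homeos G \<phi>"
    and "w \<in> carrier (free_prod t G)"
    and "w \<notin> const_words G"
    and "hereditarily_separates G \<phi>"
    and "\<exists>c \<in> carrier (free_prod t G).
           oscillating t G \<phi>
             (c \<otimes>\<^bsub>free_prod t G\<^esub> w \<otimes>\<^bsub>free_prod t G\<^esub> inv\<^bsub>free_prod t G\<^esub> c)"
  shows "(\<exists>g \<in> {1..t} \<rightarrow> carrier G. word_value G g w \<noteq> \<one>\<^bsub>G\<^esub>) \<and>
    (w \<in> free_words t \<or> block_word t G w \<longrightarrow>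
      (\<forall>U. open U \<and> U \<noteq> {} \<and> U \<subseteq> osc_set t G \<phi> w \<longrightarrow>
        (\<exists>g \<in> {1..t} \<rightarrow> carrier G.
           word_value G g w \<noteq> \<one>\<^bsub>G\<^esub> \<and>
           (\<forall>i \<in> {1..t}.
              supp \<phi> (g i) \<subseteq> osc_range t G \<phi> w U \<and>
              (\<forall>s \<in> {1..length (coeffs1 t G w)}.
                 \<phi> (g i) ` (\<phi> (coeff_prod G (coeffs1 t G w) s) ` U) =
                 \<phi> (coeff_prod G (coeffs1 t G w) s) ` U)))))"
proof -
  have "faithful_action G UNIV \<phi>"
    using assms(4) by (simp add: hereditarily_separates_def)
  then interpret separating_action G \<phi>
    by (intro separating_action.intro separating_action_axioms.intro assms(4) faithful_action.axioms(1))
  interpret F: group "free_prod t G" by (rule group_free_prod[OF is_group])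
  have one: "\<one>\<^bsub>free_prod t G\<^esub> = []" by (simp add: free_prod_def)
  obtain c where c: "c \<in> carrier (free_prod t G)"
    and osc: "oscillating t G \<phi> (c \<otimes>\<^bsub>free_prod t G\<^esub> w \<otimes>\<^bsub>free_prod t G\<^esub> inv\<^bsub>free_prod t G\<^esub> c)"
      (is "oscillating t G \<phi> ?w") using assms(5) by blast
  have w': "?w \<in> carrier (free_prod t G)" "?w \<noteq> []" "?w \<in> free_words t \<or> block_word t G ?w"
    using osc unfolding oscillating_def one by blast+
  have "osc_set t G \<phi> ?w \<noteq> {}"
    using osc osc_set_free_nonempty unfolding oscillating_def by blast
  then obtain g where g: "\<And>i. g i \<in> carrier G" "word_value G g ?w \<noteq> \<one>\<^bsub>G\<^esub>"
    using inequality_solution[OF w' osc_set_open[OF w'(1)] _ subset_refl] by blast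
  have "\<exists>g \<in> {1..t} \<rightarrow> carrier G. word_value G g w \<noteq> \<one>\<^bsub>G\<^esub>"
    using g word_value_conj_eq_one[OF is_group c assms(2), of g] by (intro bexI[of _ g]) auto
  moreover have "\<exists>g \<in> {1..t} \<rightarrow> carrier G.
      word_value G g w \<noteq> \<one>\<^bsub>G\<^esub> \<and>
      (\<forall>i \<in> {1..t}.
         supp \<phi> (g i) \<subseteq> osc_range t G \<phi> w U \<and>
         (\<forall>s \<in> {1..length (coeffs1 t G w)}.
            \<phi> (g i) ` (\<phi> (coeff_prod G (coeffs1 t G w) s) ` U) =
            \<phi> (coeff_prod G (coeffs1 t G w) s) ` U))"
    if "w \<in> free_words t \<or> block_word t G w" "open U" "U \<noteq> {}" "U \<subseteq> osc_set t G \<phi> w" for U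
  proof -
    have "w \<noteq> []" using assms(3) by (auto simp: const_words_def)
    from inequality_solution[OF assms(2) this that] obtain g where
      g: "\<forall>i. g i \<in> carrier G" "word_value G g w \<noteq> \<one>\<^bsub>G\<^esub>"
      "\<forall>i. supp \<phi> (g i) \<subseteq> osc_range t G \<phi> w U \<and>
         (\<forall>s \<in> {1..length (coeffs1 t G w)}.
            \<phi> (g i) ` (\<phi> (coeff_prod G (coeffs1 t G w) s) ` U) =
            \<phi> (coeff_prod G (coeffs1 t G w) s) ` U)"
      by (elim exE conjE)
    have "g \<in> {1..t} \<rightarrow> carrier G" using g(1) by simp
    then show ?thesis using g(2,3) by blast
  qed
  ultimately show ?thesis by blast
qed

end
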